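(* Fix $t>0$, $x_0\in\mathbb{R}$ and $\mu\in\mathbb{R}$. For $\sigma>0$ let $\gamma_{\sigma^2}$ denote the Gaussian probability measure on $\mathbb{R}$ with mean $x_0+\mu t$ and variance $\sigma^2 t$. For $n\ge 1$ define $T_n:\mathbb{R}^n\to\mathbb{R}$ by $$T_n(z_1,\dots,z_n)=\frac{\sum_{k=1}^n (z_k-x_0-t\mu)^2}{nt}.$$ Then for every $\sigma>0$, $$\gamma_{\sigma^2}^{\infty}\Big(\Big\{(z_k)_{k\in\mathbb{N}}\in\mathbb{R}^{\infty}:\ \lim_{n\to\infty}T_n(z_1,\dots,z_n)=\sigma^2\Big\}\Big)=1,$$ that is, $(T_n)_{n\ge1}$ is a consistent estimator (in the sense of everywhere convergence) of the parameter $\sigma^2$ for the family $(\gamma_{\sigma^2}^{\infty})_{\sigma^2>0}$.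
   Context: $\mathbb{N}=\{1,2,\dots\}$, and $\mathbb{R}^{\infty}=\mathbb{R}^{\mathbb{N}}$ is the space of real sequences with its Borel (product) $\sigma$-algebra. For a Borel probability measure $\gamma$ on $\mathbb{R}$, $\gamma^{\infty}$ is the infinite product measure $\gamma\otimes\gamma\otimes\cdots$ on $\mathbb{R}^{\infty}$. The measure $\gamma_{\sigma^2}$ is the law at time $t$ of the Wiener process with drift $X_t=x_0+\mu t+\sigma W_t$. Given a family $(\gamma_\theta)_{\theta\in\Theta}$ of Borel probability measures on $\mathbb{R}$, with $\Theta\subseteq\mathbb{R}$, a sequence of Borel measurable functions $T_n:\mathbb{R}^n\to\mathbb{R}$ is called a consistent estimator of $\theta$ (in the sense of everywhere convergence) for $(\gamma_\theta^\infty)_{\theta\in\Theta}$ if $\gamma_\theta^\infty(\{(x_k)_{k\in\mathbb{N}}:\lim_{n\to\infty}T_n(x_1,\dots,x_n)=\theta\})=1$ for each $\theta\in\Theta$. *)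

theory Defs
  imports "HOL-Probability.Probability"
begin

text \<open>
  Sequences are indexed by the positive integers. As usual for \<^const>\<open>PiM\<close>, the points of the
  product space over an index set are functions that are \<^const>\<open>undefined\<close> outside that set,
  so \<^term>\<open>restrict z {1..n}\<close> is the truncation of a sequence to its first \<open>n\<close> terms.
\<close>

definition infinite_power :: "real measure \<Rightarrow> (nat \<Rightarrow> real) measure" where
  "infinite_power \<gamma> = (\<Pi>\<^sub>M k\<in>{1..}. \<gamma>)"

definition consistent_estimator ::
    "real set \<Rightarrow> (real \<Rightarrow> real measure) \<Rightarrow> (nat \<Rightarrow> (nat \<Rightarrow> real) \<Rightarrow> real) \<Rightarrow> bool" where
  "consistent_estimator \<Theta> \<gamma> T \<longleftrightarrow>
     (\<forall>\<theta>\<in>\<Theta>. prob_space (\<gamma> \<theta>) \<and> sets (\<gamma> \<theta>) = sets borel) \<and>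
     (\<forall>n\<ge>1. T n \<in> borel_measurable (\<Pi>\<^sub>M k\<in>{1..n}. borel)) \<and>
     (\<forall>\<theta>\<in>\<Theta>. emeasure (infinite_power (\<gamma> \<theta>))
        {z \<in> space (infinite_power (\<gamma> \<theta>)).
           (\<lambda>n. T n (restrict z {1..n})) \<longlonglongrightarrow> \<theta>} = 1)"

text \<open>
  The second parameter of \<open>gaussian\<close> is the variance (assumed positive), whereas that of
  \<^const>\<open>normal_density\<close> is the standard deviation.
\<close>

definition gaussian :: "real \<Rightarrow> real \<Rightarrow> real measure" where
  "gaussian m v = density lborel (\<lambda>x. ennreal (normal_density m (sqrt v) x))"

definition variance_estimator ::
    "real \<Rightarrow> real \<Rightarrow> real \<Rightarrow> nat \<Rightarrow> (nat \<Rightarrow> real) \<Rightarrow> real" where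
  "variance_estimator t x0 \<mu> n z = (\<Sum>k=1..n. (z k - x0 - t * \<mu>)\<^sup>2) / (real n * t)"

end

theory Submission
  imports Defs
begin

text \<open>
  The squared deviations are independent with mean \<open>\<sigma>\<^sup>2 t\<close> and finite fourth moments, so the claim is
  the strong law of large numbers in Cantelli's fourth moment form: for independent centred
  variables the sum \<open>S\<^sub>n\<close> satisfies \<open>E S\<^sub>n\<^sup>4 = O(n\<^sup>2)\<close>, hence \<open>\<Sum>\<^sub>n (S\<^sub>n/n)\<^sup>4\<close> has finite expectation
  and its terms tend to 0 almost surely.
\<close>

section \<open>Fourth-power inequalities and a criterion for almost sure convergence to 0\<close>

text \<open>Apply \<open>(a + b)^2 \<le> 2 * (a^2 + b^2)\<close> twice. This crude bound serves only
  to make sums integrable; the sharp moments come from expanding the power.\<close>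

lemma power4_sum_le:
  fixes x y :: real
  shows "(x + y) ^ 4 \<le> 8 * (x ^ 4 + y ^ 4)"
proof -
  have sq: "(a + b)\<^sup>2 \<le> 2 * (a\<^sup>2 + b\<^sup>2)" for a b :: real
    using sum_squares_bound[of a b] by (simp add: power2_sum)
  have "(x + y) ^ 4 = ((x + y)\<^sup>2)\<^sup>2"
    by simp
  also have "\<dots> \<le> (2 * (x\<^sup>2 + y\<^sup>2))\<^sup>2"
    by (intro power_mono sq) simp
  also have "\<dots> \<le> 8 * (x ^ 4 + y ^ 4)"
    using sq[of "x\<^sup>2" "y\<^sup>2"] unfolding power_mult_distrib by simp
  finally show ?thesis .
qed

text \<open>The constant dominates when \<open>\<bar>x\<bar> \<le> 1\<close>, the fourth power
  otherwise. On a probability space, where constants are integrable, this makes a finite fourth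
  moment control all lower ones.\<close>

lemma abs_power_le_Suc_power4:
  fixes x :: real
  assumes "k \<le> 4"
  shows "\<bar>x\<bar> ^ k \<le> 1 + x ^ 4"
proof (cases "\<bar>x\<bar> \<le> 1")
  case True
  then have "\<bar>x\<bar> ^ k \<le> 1"
    by (simp add: power_le_one)
  then show ?thesis
    by (simp add: add_increasing2)
next
  case False
  then have "\<bar>x\<bar> ^ k \<le> \<bar>x\<bar> ^ 4"
    using assms by (intro power_increasing) auto
  then show ?thesis
    by simp
qed

text \<open>Sum and integral commute for nonnegative functions, so the series of the
  \<open>f n\<close> has a finite integral. It is therefore finite almost everywhere, and the terms
  of a convergent series vanish in the limit.\<close>

lemma AE_tendsto_zero_if_summable_integral:
  fixes f :: "nat \<Rightarrow> 'a \<Rightarrow> real"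
  assumes int: "\<And>n. integrable M (f n)"
    and nonneg: "\<And>n x. 0 \<le> f n x"
    and bound: "\<And>n. (\<integral>x. f n x \<partial>M) \<le> a n"
    and a: "summable a"
  shows "AE x in M. (\<lambda>n. f n x) \<longlonglongrightarrow> 0"
proof -
  have [measurable]: "f n \<in> borel_measurable M" for n
    by (rule borel_measurable_integrable[OF int])
  have nonneg_int: "0 \<le> (\<integral>x. f n x \<partial>M)" for n
    by (intro Bochner_Integration.integral_nonneg nonneg)
  have "summable (\<lambda>n. \<integral>x. f n x \<partial>M)"
    using bound nonneg_int by (intro summable_comparison_test'[OF a, of 0]) simp
  then have "(\<Sum>n. ennreal (\<integral>x. f n x \<partial>M)) \<noteq> \<infinity>"
    unfolding infinity_ennreal_def
    by (rule ennreal_suminf_neq_top) (rule nonneg_int)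
  moreover have "(\<integral>\<^sup>+x. (\<Sum>n. ennreal (f n x)) \<partial>M) = (\<Sum>n. ennreal (\<integral>x. f n x \<partial>M))"
    by (simp add: nn_integral_suminf nn_integral_eq_integral[OF int] nonneg)
  ultimately have "AE x in M. (\<Sum>n. ennreal (f n x)) \<noteq> \<infinity>"
    by (intro nn_integral_noteq_infinite) simp_all
  then show ?thesis
  proof eventually_elim
    case (elim x)
    then have "summable (\<lambda>n. f n x)"
      by (intro summable_suminf_not_top nonneg) simp
    then show ?case
      by (rule summable_LIMSEQ_zero)
  qed
qed

section \<open>Moments of sums of independent centred variables\<close>

context prob_space
begin

lemma integrable_power_if_power4:
  fixes X :: "'a \<Rightarrow> real"
  assumes [measurable]: "random_variable borel X"
    and "integrable M (\<lambda>\<omega>. X \<omega> ^ 4)" and "k \<le> 4"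
  shows "integrable M (\<lambda>\<omega>. X \<omega> ^ k)"
proof (rule Bochner_Integration.integrable_bound)
  show "integrable M (\<lambda>\<omega>. 1 + X \<omega> ^ 4)"
    using assms by simp
  show "AE \<omega> in M. norm (X \<omega> ^ k) \<le> norm (1 + X \<omega> ^ 4)"
    using abs_power_le_Suc_power4[OF \<open>k \<le> 4\<close>] by (auto simp: power_abs intro: order.trans)
qed simp

lemma integrable_power4_sum:
  fixes X Y :: "'a \<Rightarrow> real"
  assumes [measurable]: "random_variable borel X" "random_variable borel Y"
    and "integrable M (\<lambda>\<omega>. X \<omega> ^ 4)" "integrable M (\<lambda>\<omega>. Y \<omega> ^ 4)"
  shows "integrable M (\<lambda>\<omega>. (X \<omega> + Y \<omega>) ^ 4)"
proof (rule Bochner_Integration.integrable_bound)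
  show "integrable M (\<lambda>\<omega>. 8 * (X \<omega> ^ 4 + Y \<omega> ^ 4))"
    using assms by simp
  show "AE \<omega> in M. norm ((X \<omega> + Y \<omega>) ^ 4) \<le> norm (8 * (X \<omega> ^ 4 + Y \<omega> ^ 4))"
    using power4_sum_le by simp
qed simp

text \<open>Powers of independent variables are again independent, so the product rule for
  expectations applies to every mixed monomial.\<close>

lemma indep_var_expectation_power_mult:
  fixes X Y :: "'a \<Rightarrow> real"
  assumes indep: "indep_var borel X borel Y"
    and int: "integrable M (\<lambda>\<omega>. X \<omega> ^ 4)" "integrable M (\<lambda>\<omega>. Y \<omega> ^ 4)"
    and "j \<le> 4" "k \<le> 4"
  shows "integrable M (\<lambda>\<omega>. X \<omega> ^ j * Y \<omega> ^ k)"
    and "expectation (\<lambda>\<omega>. X \<omega> ^ j * Y \<omega> ^ k)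
       = expectation (\<lambda>\<omega>. X \<omega> ^ j) * expectation (\<lambda>\<omega>. Y \<omega> ^ k)"
proof -
  have rv: "random_variable borel X" "random_variable borel Y"
    using indep by (auto dest: indep_var_rv1 indep_var_rv2)
  have "indep_var borel ((\<lambda>x. x ^ j) \<circ> X) borel ((\<lambda>x. x ^ k) \<circ> Y)"
    by (rule indep_var_compose[OF indep]) auto
  then have "indep_var borel (\<lambda>\<omega>. X \<omega> ^ j) borel (\<lambda>\<omega>. Y \<omega> ^ k)"
    by (simp add: comp_def)
  note indep_var_integrable[OF this] indep_var_lebesgue_integral[OF this]
  then show "integrable M (\<lambda>\<omega>. X \<omega> ^ j * Y \<omega> ^ k)"
    and "expectation (\<lambda>\<omega>. X \<omega> ^ j * Y \<omega> ^ k)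
       = expectation (\<lambda>\<omega>. X \<omega> ^ j) * expectation (\<lambda>\<omega>. Y \<omega> ^ k)"
    using rv int \<open>j \<le> 4\<close> \<open>k \<le> 4\<close> by (simp_all add: integrable_power_if_power4)
qed

text \<open>In the binomial expansion every mixed term with a first power of \<open>X\<close> or
  \<open>Y\<close> has expectation 0. Only \<open>6 * X^2 * Y^2\<close> survives among the mixed
  terms of the fourth power.\<close>

lemma indep_var_centered_moments_sum:
  fixes X Y :: "'a \<Rightarrow> real"
  assumes indep: "indep_var borel X borel Y"
    and int: "integrable M (\<lambda>\<omega>. X \<omega> ^ 4)" "integrable M (\<lambda>\<omega>. Y \<omega> ^ 4)"
    and mean: "expectation X = 0" "expectation Y = 0"
  shows "expectation (\<lambda>\<omega>. (X \<omega> + Y \<omega>)\<^sup>2)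
       = expectation (\<lambda>\<omega>. (X \<omega>)\<^sup>2) + expectation (\<lambda>\<omega>. (Y \<omega>)\<^sup>2)"
    and "expectation (\<lambda>\<omega>. (X \<omega> + Y \<omega>) ^ 4)
       = expectation (\<lambda>\<omega>. X \<omega> ^ 4)
         + 6 * (expectation (\<lambda>\<omega>. (X \<omega>)\<^sup>2) * expectation (\<lambda>\<omega>. (Y \<omega>)\<^sup>2))
         + expectation (\<lambda>\<omega>. Y \<omega> ^ 4)"
proof -
  note I = indep_var_expectation_power_mult(1)[OF indep int]
  note E = indep_var_expectation_power_mult(2)[OF indep int]
  \<comment> \<open>The pure powers are padded with exponent 0 so that all terms have the shape
    covered by \<open>I\<close> and \<open>E\<close>.\<close>
  have "(\<lambda>\<omega>. (X \<omega> + Y \<omega>)\<^sup>2)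
      = (\<lambda>\<omega>. X \<omega> ^ 2 * Y \<omega> ^ 0 + 2 * (X \<omega> ^ 1 * Y \<omega> ^ 1) + X \<omega> ^ 0 * Y \<omega> ^ 2)"
    by (simp add: fun_eq_iff power2_sum)
  then show "expectation (\<lambda>\<omega>. (X \<omega> + Y \<omega>)\<^sup>2)
       = expectation (\<lambda>\<omega>. (X \<omega>)\<^sup>2) + expectation (\<lambda>\<omega>. (Y \<omega>)\<^sup>2)"
    using I[of 2 0] I[of 1 1] I[of 0 2] E[of 1 1] mean by simp
  have "(\<lambda>\<omega>. (X \<omega> + Y \<omega>) ^ 4)
      = (\<lambda>\<omega>. X \<omega> ^ 4 * Y \<omega> ^ 0 + 4 * (X \<omega> ^ 3 * Y \<omega> ^ 1) + 6 * (X \<omega> ^ 2 * Y \<omega> ^ 2)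
           + 4 * (X \<omega> ^ 1 * Y \<omega> ^ 3) + X \<omega> ^ 0 * Y \<omega> ^ 4)"
    by (simp add: fun_eq_iff eval_nat_numeral algebra_simps)
  then show "expectation (\<lambda>\<omega>. (X \<omega> + Y \<omega>) ^ 4)
       = expectation (\<lambda>\<omega>. X \<omega> ^ 4)
         + 6 * (expectation (\<lambda>\<omega>. (X \<omega>)\<^sup>2) * expectation (\<lambda>\<omega>. (Y \<omega>)\<^sup>2))
         + expectation (\<lambda>\<omega>. Y \<omega> ^ 4)"
    using I[of 4 0] I[of 3 1] I[of 2 2] I[of 1 3] I[of 0 4] E[of 3 1] E[of 2 2] E[of 1 3] mean
    by simp
qed

text \<open>Adding one variable raises the fourth moment by at most a constant plus 6 times a
  product of second moments. The second moment of the partial sum grows linearly, so these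
  increments add up to order \<open>n^2\<close>.\<close>

lemma fourth_moment_sum_bound:
  fixes X :: "nat \<Rightarrow> 'a \<Rightarrow> real"
  assumes indep: "indep_vars (\<lambda>_. borel) X {1..}"
    and int: "\<And>k. 1 \<le> k \<Longrightarrow> integrable M (\<lambda>\<omega>. X k \<omega> ^ 4)"
    and mean: "\<And>k. 1 \<le> k \<Longrightarrow> expectation (X k) = 0"
    and bound: "\<And>k. 1 \<le> k \<Longrightarrow> expectation (\<lambda>\<omega>. X k \<omega> ^ 4) \<le> C"
  shows "integrable M (\<lambda>\<omega>. (\<Sum>k=1..n. X k \<omega>) ^ 4)"
    and "expectation (\<lambda>\<omega>. (\<Sum>k=1..n. X k \<omega>) ^ 4) \<le> 3 * (1 + C)\<^sup>2 * (real n)\<^sup>2"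
proof -
  define S where "S = (\<lambda>n \<omega>. \<Sum>k=1..n. X k \<omega>)"
  \<comment> \<open>One constant for both moments: \<open>D\<close> exceeds \<open>C\<close>, and it
    bounds the second moments because \<open>x^2 \<le> 1 + x^4\<close>.\<close>
  define D where "D = 1 + C"
  have rv: "random_variable borel (X k)" if "1 \<le> k" for k
    using indep that by (auto simp: indep_vars_def)
  have rv_S: "random_variable borel (S n)" for n
    unfolding S_def by (intro borel_measurable_sum rv) simp
  have var: "expectation (\<lambda>\<omega>. (X k \<omega>)\<^sup>2) \<le> D" if "1 \<le> k" for k
  proof -
    have "expectation (\<lambda>\<omega>. (X k \<omega>)\<^sup>2) \<le> expectation (\<lambda>\<omega>. 1 + X k \<omega> ^ 4)"
    proof (rule integral_mono)
      show "integrable M (\<lambda>\<omega>. (X k \<omega>)\<^sup>2)"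
        by (rule integrable_power_if_power4[OF rv[OF that] int[OF that]]) simp
      show "integrable M (\<lambda>\<omega>. 1 + X k \<omega> ^ 4)"
        using int[OF that] by simp
      show "(X k \<omega>)\<^sup>2 \<le> 1 + X k \<omega> ^ 4" for \<omega>
        using abs_power_le_Suc_power4[of 2 "X k \<omega>"] by simp
    qed
    also have "\<dots> \<le> D"
      using bound[OF that] int[OF that] by (simp add: D_def prob_space)
    finally show ?thesis .
  qed
  \<comment> \<open>\<open>C\<close> is nonnegative since it bounds a fourth moment. The resulting
    \<open>1 \<le> D\<close> later gives \<open>D \<le> D^2\<close>.\<close>
  have "0 \<le> expectation (\<lambda>\<omega>. X 1 \<omega> ^ 4)"
    by (rule Bochner_Integration.integral_nonneg) simp
  then have "1 \<le> D"
    using bound[of 1] unfolding D_def by linarith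
  \<comment> \<open>The induction also carries the zero mean and the linear second-moment bound,
    which the fourth-moment step consumes.\<close>
  have "integrable M (\<lambda>\<omega>. S n \<omega> ^ 4) \<and> expectation (S n) = 0
      \<and> expectation (\<lambda>\<omega>. (S n \<omega>)\<^sup>2) \<le> D * real n
      \<and> expectation (\<lambda>\<omega>. S n \<omega> ^ 4) \<le> 3 * D\<^sup>2 * (real n)\<^sup>2" for n
  proof (induction n)
    case 0
    then show ?case
      by (simp add: S_def)
  next
    case (Suc n)
    have Suc_eq: "S (Suc n) = (\<lambda>\<omega>. X (Suc n) \<omega> + S n \<omega>)"
      by (simp add: S_def fun_eq_iff)
    have k: "1 \<le> Suc n"
      by simp
    have S: "integrable M (\<lambda>\<omega>. S n \<omega> ^ 4)" "expectation (S n) = 0"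
      using Suc.IH by auto
    have "indep_var borel (X (Suc n)) borel (S n)"
      unfolding S_def by (intro indep_vars_sum indep_vars_subset[OF indep]) auto
    note sums = indep_var_centered_moments_sum[OF this int[OF k] S(1) mean[OF k] S(2)]
    have int1: "integrable M (X (Suc n))" "integrable M (S n)"
      using integrable_power_if_power4[OF rv[OF k] int[OF k], of 1]
        integrable_power_if_power4[OF rv_S S(1), of 1] by simp_all
    have "integrable M (\<lambda>\<omega>. S (Suc n) \<omega> ^ 4)"
      unfolding Suc_eq by (rule integrable_power4_sum[OF rv[OF k] rv_S int[OF k] S(1)])
    moreover have "expectation (S (Suc n)) = 0"
      unfolding Suc_eq using S(2) int1 mean[OF k] by simp
    moreover have "expectation (\<lambda>\<omega>. (S (Suc n) \<omega>)\<^sup>2) \<le> D * real (Suc n)"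
      unfolding Suc_eq using sums(1) Suc.IH var[OF k] by (simp add: algebra_simps)
    moreover have "expectation (\<lambda>\<omega>. S (Suc n) \<omega> ^ 4) \<le> 3 * D\<^sup>2 * (real (Suc n))\<^sup>2"
    proof -
      have "expectation (\<lambda>\<omega>. (X (Suc n) \<omega>)\<^sup>2) * expectation (\<lambda>\<omega>. (S n \<omega>)\<^sup>2) \<le> D * (D * real n)"
        using var[OF k] Suc.IH \<open>1 \<le> D\<close> by (intro mult_mono) auto
      then have "expectation (\<lambda>\<omega>. S (Suc n) \<omega> ^ 4) \<le> D + 6 * (D * (D * real n)) + 3 * D\<^sup>2 * (real n)\<^sup>2"
        unfolding Suc_eq using sums(2) Suc.IH bound[OF k] by (simp add: D_def)
      also have "\<dots> \<le> D\<^sup>2 + 6 * (D * (D * real n)) + 3 * D\<^sup>2 * (real n)\<^sup>2"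
        using \<open>1 \<le> D\<close> by (simp add: power2_eq_square)
      \<comment> \<open>The factor 3 is chosen so that the increment \<open>6 * D^2 * n\<close>
        matches the cross term of \<open>3 * D^2 * (n + 1)^2\<close>.\<close>
      also have "\<dots> \<le> 3 * D\<^sup>2 * (real (Suc n))\<^sup>2"
        by (simp add: power2_eq_square algebra_simps)
      finally show ?thesis .
    qed
    ultimately show ?case
      by blast
  qed
  then show "integrable M (\<lambda>\<omega>. (\<Sum>k=1..n. X k \<omega>) ^ 4)"
    and "expectation (\<lambda>\<omega>. (\<Sum>k=1..n. X k \<omega>) ^ 4) \<le> 3 * (1 + C)\<^sup>2 * (real n)\<^sup>2"
    by (simp_all add: S_def D_def)
qed

text \<open>Dividing the quadratic bound on the fourth moment by \<open>n^4\<close> leaves a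
  multiple of \<open>1 / n^2\<close>, which is summable.\<close>

theorem strong_law_fourth_moment:
  fixes X :: "nat \<Rightarrow> 'a \<Rightarrow> real"
  assumes indep: "indep_vars (\<lambda>_. borel) X {1..}"
    and int: "\<And>k. 1 \<le> k \<Longrightarrow> integrable M (\<lambda>\<omega>. X k \<omega> ^ 4)"
    and mean: "\<And>k. 1 \<le> k \<Longrightarrow> expectation (X k) = 0"
    and bound: "\<And>k. 1 \<le> k \<Longrightarrow> expectation (\<lambda>\<omega>. X k \<omega> ^ 4) \<le> C"
  shows "AE \<omega> in M. (\<lambda>n. (\<Sum>k=1..n. X k \<omega>) / real n) \<longlonglongrightarrow> 0"
proof -
  note S = fourth_moment_sum_bound[OF assms]
  have "AE \<omega> in M. (\<lambda>n. ((\<Sum>k=1..n. X k \<omega>) / real n) ^ 4) \<longlonglongrightarrow> 0"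
  proof (rule AE_tendsto_zero_if_summable_integral)
    show "integrable M (\<lambda>\<omega>. ((\<Sum>k=1..n. X k \<omega>) / real n) ^ 4)" for n
      using S(1)[of n] by (simp add: power_divide)
    show "expectation (\<lambda>\<omega>. ((\<Sum>k=1..n. X k \<omega>) / real n) ^ 4) \<le> 3 * (1 + C)\<^sup>2 * inverse ((real n)\<^sup>2)"
      for n
    \<comment> \<open>For \<open>n = 0\<close> both sides are 0, since division by 0 and
      \<open>inverse 0\<close> yield 0.\<close>
    proof (cases "n = 0")
      case False
      have "expectation (\<lambda>\<omega>. ((\<Sum>k=1..n. X k \<omega>) / real n) ^ 4)
          = expectation (\<lambda>\<omega>. (\<Sum>k=1..n. X k \<omega>) ^ 4) / real n ^ 4"
        by (simp add: power_divide)
      also have "\<dots> \<le> 3 * (1 + C)\<^sup>2 * (real n)\<^sup>2 / real n ^ 4"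
        using S(2)[of n] by (intro divide_right_mono) auto
      also have "\<dots> = 3 * (1 + C)\<^sup>2 * inverse ((real n)\<^sup>2)"
        using False by (simp add: field_simps eval_nat_numeral)
      finally show ?thesis .
    qed simp
    show "summable (\<lambda>n. 3 * (1 + C)\<^sup>2 * inverse ((real n)\<^sup>2))"
      by (intro summable_mult inverse_power_summable) simp
  qed simp
  then show ?thesis
    by (simp add: power_tendsto_0_iff)
qed

end

section \<open>Coordinates of the infinite product measure\<close>

text \<open>Independence means that the joint law is the product of the marginals. Here the joint
  law is the product measure itself and each marginal is \<open>\<gamma>\<close>.\<close>

lemma indep_vars_infinite_power:
  assumes "prob_space \<gamma>"
  shows "prob_space.indep_vars (infinite_power \<gamma>) (\<lambda>_. \<gamma>) (\<lambda>k z. z k) {1..}"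
proof -
  interpret P: prob_space "infinite_power \<gamma>"
    unfolding infinite_power_def by (intro prob_space_PiM assms)
  \<comment> \<open>Points of the product space are extensional, so restricting them to
    \<open>{1..}\<close> changes nothing.\<close>
  have "distr (infinite_power \<gamma>) (\<Pi>\<^sub>M k\<in>{1..}. \<gamma>) (\<lambda>z. restrict (\<lambda>k. z k) {1..})
      = distr (infinite_power \<gamma>) (infinite_power \<gamma>) (\<lambda>z. z)"
    unfolding infinite_power_def
    by (intro distr_cong) (auto simp: space_PiM PiE_def extensional_restrict)
  also have "\<dots> = (\<Pi>\<^sub>M k\<in>{1..}. distr (infinite_power \<gamma>) \<gamma> (\<lambda>z. z k))"
    unfolding infinite_power_def
    by (simp add: distr_id, intro PiM_cong refl distr_PiM_component[symmetric] assms) auto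
  finally show ?thesis
    by (subst P.indep_vars_iff_distr_eq_PiM')
       (auto simp: infinite_power_def)
qed

lemma integral_infinite_power_component:
  fixes h :: "real \<Rightarrow> real"
  assumes "prob_space \<gamma>" and "1 \<le> k" and [measurable]: "h \<in> borel_measurable \<gamma>"
  shows "integrable (infinite_power \<gamma>) (\<lambda>z. h (z k)) \<longleftrightarrow> integrable \<gamma> h"
    and "(\<integral>z. h (z k) \<partial>infinite_power \<gamma>) = (\<integral>x. h x \<partial>\<gamma>)"
proof -
  have [measurable]: "(\<lambda>z. z k) \<in> infinite_power \<gamma> \<rightarrow>\<^sub>M \<gamma>"
    using \<open>1 \<le> k\<close> by (auto simp: infinite_power_def)
  have "distr (infinite_power \<gamma>) \<gamma> (\<lambda>z. z k) = \<gamma>"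
    unfolding infinite_power_def using assms by (intro distr_PiM_component) auto
  then show "integrable (infinite_power \<gamma>) (\<lambda>z. h (z k)) \<longleftrightarrow> integrable \<gamma> h"
    and "(\<integral>z. h (z k) \<partial>infinite_power \<gamma>) = (\<integral>x. h x \<partial>\<gamma>)"
    using integrable_distr_eq[of "\<lambda>z. z k" "infinite_power \<gamma>" \<gamma> h]
      integral_distr[of "\<lambda>z. z k" "infinite_power \<gamma>" \<gamma> h] by simp_all
qed

text \<open>The centred variables \<open>h (z k) - m\<close> share one law, so their common fourth
  moment serves as the uniform bound.\<close>

lemma strong_law_infinite_power:
  fixes h :: "real \<Rightarrow> real"
  assumes \<gamma>: "prob_space \<gamma>" and [measurable]: "h \<in> borel_measurable \<gamma>"
    and int: "integrable \<gamma> (\<lambda>x. h x ^ 4)"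
  shows "AE z in infinite_power \<gamma>. (\<lambda>n. (\<Sum>k=1..n. h (z k)) / real n) \<longlonglongrightarrow> (\<integral>x. h x \<partial>\<gamma>)"
proof -
  interpret G: prob_space \<gamma> by fact
  interpret P: prob_space "infinite_power \<gamma>"
    unfolding infinite_power_def by (intro prob_space_PiM \<gamma>)
  define m where "m = (\<integral>x. h x \<partial>\<gamma>)"
  have int1: "integrable \<gamma> h"
    using G.integrable_power_if_power4[OF _ int, of 1] by simp
  \<comment> \<open>Centring is treated as adding the constant variable \<open>- m\<close>.\<close>
  have int4: "integrable \<gamma> (\<lambda>x. (h x - m) ^ 4)"
    using G.integrable_power4_sum[OF _ _ int, of "\<lambda>_. - m"] by simp
  note component = integral_infinite_power_component[OF \<gamma>]
  have "AE z in infinite_power \<gamma>. (\<lambda>n. (\<Sum>k=1..n. h (z k) - m) / real n) \<longlonglongrightarrow> 0"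
  proof (rule P.strong_law_fourth_moment)
    show "P.indep_vars (\<lambda>_. borel) (\<lambda>k z. h (z k) - m) {1..}"
      by (rule P.indep_vars_compose2[OF indep_vars_infinite_power[OF \<gamma>]]) simp
    fix k :: nat
    assume k: "1 \<le> k"
    show "integrable (infinite_power \<gamma>) (\<lambda>z. (h (z k) - m) ^ 4)"
      using component(1)[OF k, of "\<lambda>x. (h x - m) ^ 4"] int4 by simp
    show "P.expectation (\<lambda>z. h (z k) - m) = 0"
      using component(2)[OF k, of "\<lambda>x. h x - m"] int1 by (simp add: m_def G.prob_space)
    show "P.expectation (\<lambda>z. (h (z k) - m) ^ 4) \<le> (\<integral>x. (h x - m) ^ 4 \<partial>\<gamma>)"
      using component(2)[OF k, of "\<lambda>x. (h x - m) ^ 4"] by simp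
  qed
  then show ?thesis
    unfolding m_def[symmetric]
  proof eventually_elim
    case (elim z)
    then have "(\<lambda>n. (\<Sum>k=1..n. h (z k) - m) / real n + m) \<longlonglongrightarrow> 0 + m"
      by (intro tendsto_add tendsto_const)
    \<comment> \<open>The identity is only eventual: at \<open>n = 0\<close> the left side is
      \<open>m\<close> and the right side 0.\<close>
    moreover have "\<forall>\<^sub>F n in sequentially.
        (\<Sum>k=1..n. h (z k) - m) / real n + m = (\<Sum>k=1..n. h (z k)) / real n"
      using eventually_gt_at_top[of 0]
      by eventually_elim (simp add: sum_subtractf field_simps)
    ultimately show ?case
      by (simp del: One_nat_def add: tendsto_cong)
  qed
qed

section \<open>Gaussian moments and consistency of the variance estimator\<close>

lemma sets_gaussian [simp, measurable_cong]: "sets (gaussian m v) = sets borel"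
  by (simp add: gaussian_def)

lemma prob_space_gaussian: "0 < v \<Longrightarrow> prob_space (gaussian m v)"
  unfolding gaussian_def by (intro prob_space_normal_density) simp

lemma integrable_gaussian_centered_power:
  assumes "0 < v"
  shows "integrable (gaussian m v) (\<lambda>x. (x - m) ^ k)"
  unfolding gaussian_def using assms
  by (subst integrable_density) (auto intro: integrable_normal_moment)

lemma integral_gaussian_centered_square:
  assumes "0 < v"
  shows "(\<integral>x. (x - m)\<^sup>2 \<partial>gaussian m v) = v"
  \<comment> \<open>The even-moment formula at index 1 is the second central moment, the square of
    the standard deviation \<open>sqrt v\<close>.\<close>
  unfolding gaussian_def using assms integral_normal_moment_even[of "sqrt v" m 1]
  by (subst integral_density) auto

lemma measurable_variance_estimator [measurable]:
  "variance_estimator t x0 \<mu> n \<in> borel_measurable (\<Pi>\<^sub>M k\<in>{1..n}. borel)"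
  unfolding variance_estimator_def by measurable

lemma AE_variance_estimator_tendsto:
  fixes t x0 \<mu> \<theta> :: real
  assumes "0 < t" "0 < \<theta>"
  shows "AE z in infinite_power (gaussian (x0 + \<mu> * t) (\<theta> * t)).
           (\<lambda>n. variance_estimator t x0 \<mu> n (restrict z {1..n})) \<longlonglongrightarrow> \<theta>"
proof -
  define m where "m = x0 + \<mu> * t"
  have v: "0 < \<theta> * t"
    using assms by simp
  have "AE z in infinite_power (gaussian m (\<theta> * t)).
      (\<lambda>n. (\<Sum>k=1..n. (z k - m)\<^sup>2) / real n) \<longlonglongrightarrow> (\<integral>x. (x - m)\<^sup>2 \<partial>gaussian m (\<theta> * t))"
    \<comment> \<open>The strong law is used with \<open>h x = (x - m)^2\<close>, whose fourth power
      is the eighth power of \<open>x - m\<close>.\<close>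
    using integrable_gaussian_centered_power[OF v, of m 8]
    by (intro strong_law_infinite_power prob_space_gaussian v) (simp_all flip: power_mult)
  then show ?thesis
    unfolding m_def[symmetric]
  proof eventually_elim
    case (elim z)
    then have "(\<lambda>n. (\<Sum>k=1..n. (z k - m)\<^sup>2) / real n / t) \<longlonglongrightarrow> \<theta> * t / t"
      using \<open>0 < t\<close> by (intro tendsto_divide) (auto simp: integral_gaussian_centered_square[OF v])
    \<comment> \<open>The estimator is the sample mean of the squared deviations divided by
      \<open>t\<close>, which turns the limit \<open>\<theta> * t\<close> into
      \<open>\<theta>\<close>.\<close>
    moreover have "variance_estimator t x0 \<mu> n (restrict z {1..n})
        = (\<Sum>k=1..n. (z k - m)\<^sup>2) / real n / t" for n
      by (simp add: variance_estimator_def m_def algebra_simps)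
    ultimately show ?case
      using \<open>0 < t\<close> by simp
  qed
qed

text \<open>Passing from an almost sure statement to measure 1 requires the convergence event to be
  measurable; this follows from measurability of each estimator composed with truncation.\<close>

lemma emeasure_variance_estimator_tendsto:
  fixes t x0 \<mu> \<theta> :: real
  assumes "0 < t" "0 < \<theta>"
  defines "P \<equiv> infinite_power (gaussian (x0 + \<mu> * t) (\<theta> * t))"
  shows "emeasure P {z \<in> space P.
           (\<lambda>n. variance_estimator t x0 \<mu> n (restrict z {1..n})) \<longlonglongrightarrow> \<theta>} = 1"
proof -
  interpret prob_space P
    unfolding P_def infinite_power_def using assms by (intro prob_space_PiM prob_space_gaussian) simp
  have [measurable]: "(\<lambda>z. variance_estimator t x0 \<mu> n (restrict z {1..n})) \<in> borel_measurable P" for n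
  proof (rule measurable_compose[OF _ measurable_variance_estimator])
    show "(\<lambda>z. restrict z {1..n}) \<in> P \<rightarrow>\<^sub>M (\<Pi>\<^sub>M k\<in>{1..n}. borel)"
      unfolding P_def infinite_power_def by (intro measurable_restrict) simp
  qed
  show ?thesis
  proof (rule emeasure_eq_1_AE)
    show "AE z in P. z \<in> {z \<in> space P.
        (\<lambda>n. variance_estimator t x0 \<mu> n (restrict z {1..n})) \<longlonglongrightarrow> \<theta>}"
      using AE_variance_estimator_tendsto[OF assms(1,2), of x0 \<mu>] AE_space
      unfolding P_def by eventually_elim simp
  qed measurable
qed

theorem theorem3p1p1:
  fixes t x0 \<mu> :: real
  assumes "t > 0"
  shows "(\<forall>\<sigma>>0. emeasure (infinite_power (gaussian (x0 + \<mu> * t) (\<sigma>\<^sup>2 * t)))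
            {z \<in> space (infinite_power (gaussian (x0 + \<mu> * t) (\<sigma>\<^sup>2 * t))).
               (\<lambda>n. variance_estimator t x0 \<mu> n (restrict z {1..n})) \<longlonglongrightarrow> \<sigma>\<^sup>2} = 1)
       \<and> consistent_estimator {0<..} (\<lambda>\<theta>. gaussian (x0 + \<mu> * t) (\<theta> * t))
            (variance_estimator t x0 \<mu>)"
  \<comment> \<open>The first conjunct is the instance \<open>\<theta> = \<sigma>^2\<close>, which
    is positive for \<open>\<sigma> > 0\<close>.\<close>
  using assms emeasure_variance_estimator_tendsto[OF assms]
  by (simp del: One_nat_def
      add: consistent_estimator_def prob_space_gaussian measurable_variance_estimator)

end
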